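(* Let $\Omega_1\subset\mathbb{R}^n$ and $\Omega_2\subset\mathbb{R}^m$ be nonempty convex sets. For nonempty index sets $I\subset\{1,\dots,n\}$ and $J\subset\{1,\dots,m\}$, put $K:=I\cup\{n+j\mid j\in J\}\subset\{1,\dots,n+m\}$. Assume that $\pi_I(\Omega_1)$ and $\pi_J(\Omega_2)$ are unbounded. Then: (i) $T(\infty_K;\Omega_1\times\Omega_2)\subset T(\infty_I;\Omega_1)\times T(\infty_J;\Omega_2)$; (ii) $N(\infty_I;\Omega_1)\times N(\infty_J;\Omega_2)\subset N(\infty_K;\Omega_1\times\Omega_2)$.
   Context: Euclidean inner products and norms are used. For a nonempty index set $I\subset\{1,\dots,p\}$, $\pi_I:\mathbb{R}^p\to\mathbb{R}^{|I|}$ is $\pi_I(x)=(x_i)_{i\in I}$; in particular $\pi_K$ is the projection on $\mathbb{R}^n\times\mathbb{R}^m=\mathbb{R}^{n+m}$ to the coordinates in $K$. For a nonempty convex set $\Omega\subset\mathbb{R}^p$, the tangent cone at infinity $T(\infty_I;\Omega)$ is the set of $w\in\mathbb{R}^p$ such that for all sequences $x_k\in\Omega$ with $\|\pi_I(x_k)\|\to\infty$ and all $t_k>0$ with $t_k\to 0$ there exist $w_k\to w$ with $x_k+t_kw_k\in\Omega$ for all $k$. The normal cone at infinity is $N(\infty_I;\Omega)=\{v\mid\langle v,w\rangle\le 0\ \forall w\in T(\infty_I;\Omega)\}$. *)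

theory Defs
  imports "HOL-Analysis.Analysis"
begin

text \<open>
  Coordinates of \<open>\<real>\<^sup>p\<close> are indexed by a finite type with \<open>p\<close> elements; \<open>\<real>\<^sup>n\<^sup>+\<^sup>m\<close> is
  \<^typ>\<open>real ^ ('n::finite + 'm::finite)\<close>, the index \<open>i \<le> n\<close> being \<open>Inl i\<close> and the index
  \<open>n + j\<close> being \<open>Inr j\<close>.

  The target \<open>\<real>\<^bsup>|I|\<^esup>\<close> of \<open>\<pi>\<^sub>I\<close> depends on the set \<open>I\<close>, so it is represented by the
  coordinate subspace of vectors vanishing off \<open>I\<close>; the lemma below shows that
  the norm is that of \<open>\<real>\<^bsup>|I|\<^esup>\<close>.
\<close>

definition coord_proj :: "'p set \<Rightarrow> real ^ 'p \<Rightarrow> real ^ 'p::finite" where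
  "coord_proj I x = (\<chi> i. if i \<in> I then x $ i else 0)"

lemma norm_coord_proj: "norm (coord_proj I x) = sqrt (\<Sum>i\<in>I. (x $ i)\<^sup>2)"
proof -
  have "(\<Sum>i\<in>UNIV. (coord_proj I x $ i)\<^sup>2) = (\<Sum>i\<in>UNIV. if i \<in> I then (x $ i)\<^sup>2 else 0)"
    by (intro sum.cong) (auto simp: coord_proj_def)
  also have "\<dots> = (\<Sum>i\<in>I. (x $ i)\<^sup>2)"
    by (simp add: sum.If_cases)
  finally show ?thesis
    by (simp add: norm_vec_def L2_set_def)
qed

definition tangent_cone_inf :: "'p set \<Rightarrow> (real ^ 'p::finite) set \<Rightarrow> (real ^ 'p) set" where
  "tangent_cone_inf I \<Omega> =
     {w. \<forall>(x :: nat \<Rightarrow> real ^ 'p) (t :: nat \<Rightarrow> real).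
           (\<forall>k. x k \<in> \<Omega>) \<and> filterlim (\<lambda>k. norm (coord_proj I (x k))) at_top sequentially \<and>
           (\<forall>k. t k > 0) \<and> t \<longlonglongrightarrow> 0 \<longrightarrow>
           (\<exists>u :: nat \<Rightarrow> real ^ 'p. u \<longlonglongrightarrow> w \<and> (\<forall>k. x k + t k *\<^sub>R u k \<in> \<Omega>))}"

definition normal_cone_inf :: "'p set \<Rightarrow> (real ^ 'p::finite) set \<Rightarrow> (real ^ 'p) set" where
  "normal_cone_inf I \<Omega> = {v. \<forall>w \<in> tangent_cone_inf I \<Omega>. v \<bullet> w \<le> 0}"

definition vec_join :: "real ^ 'n::finite \<Rightarrow> real ^ 'm::finite \<Rightarrow> real ^ ('n + 'm)" where
  "vec_join x y = (\<chi> i. case i of Inl a \<Rightarrow> x $ a | Inr b \<Rightarrow> y $ b)"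

text \<open>The Cartesian product of subsets of \<open>\<real>\<^sup>n\<close> and \<open>\<real>\<^sup>m\<close>, viewed as a subset of \<open>\<real>\<^sup>n\<^sup>+\<^sup>m\<close>.\<close>

definition vec_prod ::
    "(real ^ 'n::finite) set \<Rightarrow> (real ^ 'm::finite) set \<Rightarrow> (real ^ ('n + 'm)) set"
    (infixr "\<times>\<^sub>v" 80) where
  "A \<times>\<^sub>v B = {vec_join x y | x y. x \<in> A \<and> y \<in> B}"

end

theory Submission
  imports Defs
begin

text \<open>
  A sequence in one factor that escapes to infinity in \<open>I\<close> lifts, by keeping the other coordinate
  at a fixed point, to a sequence in the product that escapes to infinity in \<open>K\<close>. The
  perturbations that membership in the product tangent cone supplies for the lifted sequence
  project to the required ones. The lifting only uses that the factor is the image of the product under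
  a coordinate projection, so both factors are treated at once. Since inner products split over
  the factors, the inclusion of normal cones follows by polarity.
\<close>

text \<open>For \<open>\<sigma>\<close> equal to \<open>Inl\<close> or \<open>Inr\<close> this is
  the projection of the product space onto its first or second factor.\<close>

definition coord_pull :: "('q \<Rightarrow> 'p) \<Rightarrow> real ^ 'p::finite \<Rightarrow> real ^ 'q::finite" where
  "coord_pull \<sigma> z = (\<chi> a. z $ \<sigma> a)"

text \<open>Injectivity turns the sum of squares over \<open>I\<close> into one over its image in
  \<open>K\<close>, and the remaining squares are nonnegative. Hence a lift of a sequence escaping
  in \<open>I\<close> escapes in \<open>K\<close>.\<close>

lemma norm_coord_proj_coord_pull_le:
  assumes "inj_on \<sigma> I" and "\<sigma> ` I \<subseteq> K"
  shows "norm (coord_proj I (coord_pull \<sigma> z)) \<le> norm (coord_proj K z)"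
proof -
  have "(\<Sum>i\<in>I. (coord_pull \<sigma> z $ i)\<^sup>2) = (\<Sum>i\<in>\<sigma> ` I. (z $ i)\<^sup>2)"
    by (simp add: coord_pull_def sum.reindex[OF assms(1)])
  also have "\<dots> \<le> (\<Sum>i\<in>K. (z $ i)\<^sup>2)"
    using assms(2) by (intro sum_mono2) auto
  finally show ?thesis
    by (simp add: norm_coord_proj)
qed

lemma coord_pull_tangent_cone_inf:
  fixes \<sigma> :: "'q::finite \<Rightarrow> 'p::finite"
  assumes w: "w \<in> tangent_cone_inf K \<Omega>"
    and inj: "inj_on \<sigma> I" and sub: "\<sigma> ` I \<subseteq> K"
  shows "coord_pull \<sigma> w \<in> tangent_cone_inf I (coord_pull \<sigma> ` \<Omega>)"
  unfolding tangent_cone_inf_def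
proof (intro CollectI allI impI, elim conjE)
  fix x :: "nat \<Rightarrow> real ^ 'q" and t :: "nat \<Rightarrow> real"
  assume x: "\<forall>k. x k \<in> coord_pull \<sigma> ` \<Omega>"
    and lim: "filterlim (\<lambda>k. norm (coord_proj I (x k))) at_top sequentially"
    and t: "\<forall>k. t k > 0" "t \<longlonglongrightarrow> 0"
  from x have "\<forall>k. \<exists>z\<in>\<Omega>. x k = coord_pull \<sigma> z"
    by (simp add: image_iff)
  \<comment> \<open>Any choice of preimages serves as the lift: the norm bound controls its escape
    whatever the other coordinates are.\<close>
  then obtain z where z: "\<And>k. z k \<in> \<Omega>" "\<And>k. x k = coord_pull \<sigma> (z k)"
    by metis
  have "filterlim (\<lambda>k. norm (coord_proj K (z k))) at_top sequentially"
    using lim by (rule filterlim_at_top_mono)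
      (simp add: z(2) norm_coord_proj_coord_pull_le[OF inj sub])
  then obtain u where u: "u \<longlonglongrightarrow> w" "\<And>k. z k + t k *\<^sub>R u k \<in> \<Omega>"
    using w[unfolded tangent_cone_inf_def, THEN CollectD, rule_format, of z t] z(1) t by auto
  have "(\<lambda>k. coord_pull \<sigma> (u k)) \<longlonglongrightarrow> coord_pull \<sigma> w"
    unfolding coord_pull_def by (intro tendsto_vec_lambda tendsto_vec_nth u(1))
  \<comment> \<open>By linearity of \<open>coord_pull\<close>, the perturbed lift projects to the
    perturbed original sequence.\<close>
  moreover have "x k + t k *\<^sub>R coord_pull \<sigma> (u k) = coord_pull \<sigma> (z k + t k *\<^sub>R u k)" for k
    by (simp add: z(2) coord_pull_def vec_eq_iff)
  ultimately show "\<exists>v. v \<longlonglongrightarrow> coord_pull \<sigma> w \<and> (\<forall>k. x k + t k *\<^sub>R v k \<in> coord_pull \<sigma> ` \<Omega>)"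
    using u(2) by (intro exI[of _ "\<lambda>k. coord_pull \<sigma> (u k)"]) auto
qed

lemma coord_pull_vec_join [simp]:
  "coord_pull Inl (vec_join x y) = x" "coord_pull Inr (vec_join x y) = y"
  by (simp_all add: coord_pull_def vec_join_def vec_eq_iff)

lemma vec_join_coord_pull: "vec_join (coord_pull Inl z) (coord_pull Inr z) = z"
  by (simp add: coord_pull_def vec_join_def vec_eq_iff split: sum.split)

lemma vec_prod_eq_image: "A \<times>\<^sub>v B = (\<lambda>(x, y). vec_join x y) ` (A \<times> B)"
  by (auto simp: vec_prod_def)

text \<open>A point of \<open>B\<close> is what completes each element of \<open>A\<close> to an
  element of the product.\<close>

lemma coord_pull_Inl_vec_prod: "B \<noteq> {} \<Longrightarrow> coord_pull Inl ` (A \<times>\<^sub>v B) = A"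
  by (simp add: vec_prod_eq_image image_image case_prod_beta' fst_image_times)

lemma coord_pull_Inr_vec_prod: "A \<noteq> {} \<Longrightarrow> coord_pull Inr ` (A \<times>\<^sub>v B) = B"
  by (simp add: vec_prod_eq_image image_image case_prod_beta' snd_image_times)

lemma inner_vec_join: "vec_join a b \<bullet> vec_join c d = a \<bullet> c + b \<bullet> d"
  by (simp add: inner_vec_def vec_join_def sum.Plus flip: UNIV_Plus_UNIV)

lemma tangent_cone_inf_vec_prod_subset:
  assumes "A \<noteq> {}" and "B \<noteq> {}"
  shows "tangent_cone_inf (Inl ` I \<union> Inr ` J) (A \<times>\<^sub>v B)
           \<subseteq> tangent_cone_inf I A \<times>\<^sub>v tangent_cone_inf J B"
proof
  fix w assume w: "w \<in> tangent_cone_inf (Inl ` I \<union> Inr ` J) (A \<times>\<^sub>v B)"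
  have "coord_pull Inl w \<in> tangent_cone_inf I A"
    using coord_pull_tangent_cone_inf[OF w, of Inl I] assms(2)
    by (simp add: coord_pull_Inl_vec_prod)
  moreover have "coord_pull Inr w \<in> tangent_cone_inf J B"
    using coord_pull_tangent_cone_inf[OF w, of Inr J] assms(1)
    by (simp add: coord_pull_Inr_vec_prod)
  ultimately show "w \<in> tangent_cone_inf I A \<times>\<^sub>v tangent_cone_inf J B"
    unfolding vec_prod_def using vec_join_coord_pull[of w, symmetric] by blast
qed

text \<open>Polarity reverses the tangent inclusion: a tangent vector of the product splits into
  tangent vectors of the factors, so its inner product with a joined pair of normals is a sum of two
  nonpositive terms.\<close>

lemma normal_cone_inf_vec_prod_subset:
  assumes "A \<noteq> {}" and "B \<noteq> {}"
  shows "normal_cone_inf I A \<times>\<^sub>v normal_cone_inf J B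
           \<subseteq> normal_cone_inf (Inl ` I \<union> Inr ` J) (A \<times>\<^sub>v B)"
proof
  fix v assume "v \<in> normal_cone_inf I A \<times>\<^sub>v normal_cone_inf J B"
  then obtain a b where v: "v = vec_join a b" "a \<in> normal_cone_inf I A" "b \<in> normal_cone_inf J B"
    by (auto simp: vec_prod_def)
  have "v \<bullet> w \<le> 0" if w: "w \<in> tangent_cone_inf (Inl ` I \<union> Inr ` J) (A \<times>\<^sub>v B)" for w
  proof -
    obtain c d where "w = vec_join c d" "c \<in> tangent_cone_inf I A" "d \<in> tangent_cone_inf J B"
      using subsetD[OF tangent_cone_inf_vec_prod_subset[OF assms] w]
      by (auto simp: vec_prod_def)
    with v show ?thesis
      by (auto simp: inner_vec_join normal_cone_inf_def intro: add_nonpos_nonpos)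
  qed
  then show "v \<in> normal_cone_inf (Inl ` I \<union> Inr ` J) (A \<times>\<^sub>v B)"
    by (simp add: normal_cone_inf_def)
qed

theorem proposition3p15:
  fixes \<Omega>\<^sub>1 :: "(real ^ 'n::finite) set" and \<Omega>\<^sub>2 :: "(real ^ 'm::finite) set"
    and I :: "'n set" and J :: "'m set" and K :: "('n + 'm) set"
  assumes "convex \<Omega>\<^sub>1" and "\<Omega>\<^sub>1 \<noteq> {}"
    and "convex \<Omega>\<^sub>2" and "\<Omega>\<^sub>2 \<noteq> {}"
    and "I \<noteq> {}" and "J \<noteq> {}"
    and "K = Inl ` I \<union> Inr ` J"
    and "\<not> bounded (coord_proj I ` \<Omega>\<^sub>1)"
    and "\<not> bounded (coord_proj J ` \<Omega>\<^sub>2)"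
  shows "tangent_cone_inf K (\<Omega>\<^sub>1 \<times>\<^sub>v \<Omega>\<^sub>2) \<subseteq> tangent_cone_inf I \<Omega>\<^sub>1 \<times>\<^sub>v tangent_cone_inf J \<Omega>\<^sub>2 \<and>
         normal_cone_inf I \<Omega>\<^sub>1 \<times>\<^sub>v normal_cone_inf J \<Omega>\<^sub>2 \<subseteq> normal_cone_inf K (\<Omega>\<^sub>1 \<times>\<^sub>v \<Omega>\<^sub>2)"
  unfolding assms(7)
  using tangent_cone_inf_vec_prod_subset[OF assms(2,4)]
    normal_cone_inf_vec_prod_subset[OF assms(2,4)] by (intro conjI)

end
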